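(* Let $V$ be an object in a symmetric category $(\mathcal{C},\otimes,\mathbf{I},c)$, equipped with two morphisms $\mu:V\otimes V\to V$ and $\nu:\mathbf{I}\to V$ such that $\nu$ is a right unit for $\mu$, i.e. $\mu\circ(\operatorname{Id}_V\otimes\nu)=\operatorname{Id}_V$. Put $\Delta_{Ass}:=\nu\otimes\operatorname{Id}_V:V\to V\otimes V$. Then the triple $(V,\Delta_{Ass},\mu)$ (with $\mu$ in the role of $\lhd$) satisfies all the conditions in the definition of a shelf in $\mathcal{C}$ except possibly generalized self-distributivity (GSD), and GSD for $(V,\Delta_{Ass},\mu)$ is equivalent to the associativity of $\mu$. Moreover, if $(V,\mu,\nu)$ is a unital associative algebra in $\mathcal{C}$, then the braiding $\sigma_{V,\Delta_{Ass},\mu}=\mu_2\circ c_1\circ(\Delta_{Ass})_2$ coincides with $\sigma_{V,\mu}:=\nu\otimes\mu:V\otimes V=\mathbf{I}\otimes V\otimes V\to V\otimes V$.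
   Context: All monoidal categories are strict; a symmetric category is a strict symmetric monoidal category. For $\varphi:V^{\otimes l}\to V^{\otimes r}$, $\varphi_i:=\operatorname{Id}_V^{\otimes(i-1)}\otimes\varphi\otimes\operatorname{Id}_V^{\otimes(k-i+1)}:V^{\otimes(k+l)}\to V^{\otimes(k+r)}$, and $\varphi^n:=\varphi_1\circ\cdots\circ\varphi_1$ ($n$ times). $c$ means $c_{V,V}$. A shelf in $\mathcal{C}$ is an object $V$ with $\Delta:V\to V\otimes V$ and $\lhd:V\otimes V\to V$ such that: (1) $\Delta$ is coassociative, $\Delta_1\circ\Delta=\Delta_2\circ\Delta$, and weakly cocommutative, $c_2\circ\Delta^3=\Delta^3:V\to V^{\otimes4}$; (2) (GSD) $\lhd^2=\lhd\circ(\lhd\otimes\lhd)\circ c_2\circ\Delta_3:V^{\otimes3}\to V$; (3) (compatibility) $\Delta\circ\lhd=(\lhd\otimes\lhd)\circ c_2\circ(\Delta\otimes\Delta):V^{\otimes2}\to V^{\otimes2}$. *)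

theory Defs
  imports Main
begin

section \<open>Strict symmetric monoidal categories\<close>

record ('o, 'm) monoidal_data =
  Obj :: "'o set"
  Mor :: "'m set"
  dom :: "'m \<Rightarrow> 'o"
  cod :: "'m \<Rightarrow> 'o"
  ident :: "'o \<Rightarrow> 'm" ("Id\<index>")
  compose :: "'m \<Rightarrow> 'm \<Rightarrow> 'm" (infixr "\<cdot>\<index>" 65)
  tensor_obj :: "'o \<Rightarrow> 'o \<Rightarrow> 'o" (infixr "\<otimes>\<index>" 75)
  tensor_mor :: "'m \<Rightarrow> 'm \<Rightarrow> 'm" (infixr "\<boxtimes>\<index>" 75)
  unit_obj :: "'o" ("\<I>\<index>")
  braid :: "'o \<Rightarrow> 'o \<Rightarrow> 'm" ("\<c>\<index>")

text \<open>
  The tensor product is written \<open>\<otimes>\<close> on objects and \<open>\<boxtimes>\<close> on morphisms;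
  \<open>g \<cdot> f\<close> is the composite \<open>g \<circ> f\<close>.
\<close>

definition Hom :: "('o, 'm) monoidal_data \<Rightarrow> 'o \<Rightarrow> 'o \<Rightarrow> 'm set" where
  "Hom C A B = {f \<in> Mor C. dom C f = A \<and> cod C f = B}"

locale category =
  fixes C :: "('o, 'm) monoidal_data" (structure)
  assumes dom_closed: "f \<in> Mor C \<Longrightarrow> dom C f \<in> Obj C"
    and cod_closed: "f \<in> Mor C \<Longrightarrow> cod C f \<in> Obj C"
    and ident_closed: "A \<in> Obj C \<Longrightarrow> Id A \<in> Hom C A A"
    and compose_closed: "f \<in> Hom C A B \<Longrightarrow> g \<in> Hom C B D \<Longrightarrow> g \<cdot> f \<in> Hom C A D"
    and compose_ident_left: "f \<in> Hom C A B \<Longrightarrow> Id B \<cdot> f = f"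
    and compose_ident_right: "f \<in> Hom C A B \<Longrightarrow> f \<cdot> Id A = f"
    and compose_assoc:
      "f \<in> Hom C A B \<Longrightarrow> g \<in> Hom C B D \<Longrightarrow> h \<in> Hom C D E \<Longrightarrow> (h \<cdot> g) \<cdot> f = h \<cdot> (g \<cdot> f)"

locale strict_monoidal_category = category +
  assumes unit_obj_closed: "\<I> \<in> Obj C"
    and tensor_obj_closed: "A \<in> Obj C \<Longrightarrow> B \<in> Obj C \<Longrightarrow> A \<otimes> B \<in> Obj C"
    and tensor_mor_closed:
      "f \<in> Hom C A B \<Longrightarrow> g \<in> Hom C A' B' \<Longrightarrow> f \<boxtimes> g \<in> Hom C (A \<otimes> A') (B \<otimes> B')"
    and tensor_ident: "A \<in> Obj C \<Longrightarrow> B \<in> Obj C \<Longrightarrow> Id A \<boxtimes> Id B = Id (A \<otimes> B)"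
    and tensor_compose:
      "f \<in> Hom C A B \<Longrightarrow> g \<in> Hom C B D \<Longrightarrow> f' \<in> Hom C A' B' \<Longrightarrow> g' \<in> Hom C B' D' \<Longrightarrow>
        (g \<cdot> f) \<boxtimes> (g' \<cdot> f') = (g \<boxtimes> g') \<cdot> (f \<boxtimes> f')"
    and tensor_obj_assoc:
      "A \<in> Obj C \<Longrightarrow> B \<in> Obj C \<Longrightarrow> D \<in> Obj C \<Longrightarrow> (A \<otimes> B) \<otimes> D = A \<otimes> (B \<otimes> D)"
    and tensor_mor_assoc:
      "f \<in> Mor C \<Longrightarrow> g \<in> Mor C \<Longrightarrow> h \<in> Mor C \<Longrightarrow> (f \<boxtimes> g) \<boxtimes> h = f \<boxtimes> (g \<boxtimes> h)"
    and tensor_obj_unit_left: "A \<in> Obj C \<Longrightarrow> \<I> \<otimes> A = A"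
    and tensor_obj_unit_right: "A \<in> Obj C \<Longrightarrow> A \<otimes> \<I> = A"
    and tensor_mor_unit_left: "f \<in> Mor C \<Longrightarrow> Id \<I> \<boxtimes> f = f"
    and tensor_mor_unit_right: "f \<in> Mor C \<Longrightarrow> f \<boxtimes> Id \<I> = f"

text \<open>
  The second hexagon identity and \<open>\<c> A \<I> = Id A\<close> follow from the axioms below.
\<close>

locale strict_symmetric_category = strict_monoidal_category +
  assumes braid_closed:
      "A \<in> Obj C \<Longrightarrow> B \<in> Obj C \<Longrightarrow> \<c> A B \<in> Hom C (A \<otimes> B) (B \<otimes> A)"
    and braid_natural:
      "f \<in> Hom C A B \<Longrightarrow> g \<in> Hom C A' B' \<Longrightarrow>
        \<c> B B' \<cdot> (f \<boxtimes> g) = (g \<boxtimes> f) \<cdot> \<c> A A'"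
    and braid_hexagon:
      "A \<in> Obj C \<Longrightarrow> B \<in> Obj C \<Longrightarrow> D \<in> Obj C \<Longrightarrow>
        \<c> A (B \<otimes> D) = (Id B \<boxtimes> \<c> A D) \<cdot> (\<c> A B \<boxtimes> Id D)"
    and braid_symmetric:
      "A \<in> Obj C \<Longrightarrow> B \<in> Obj C \<Longrightarrow> \<c> B A \<cdot> \<c> A B = Id (A \<otimes> B)"


section \<open>Morphisms between tensor powers of an object\<close>

primrec tensor_power :: "('o, 'm) monoidal_data \<Rightarrow> 'o \<Rightarrow> nat \<Rightarrow> 'o" where
  "tensor_power C V 0 = \<I>\<^bsub>C\<^esub>"
| "tensor_power C V (Suc n) = V \<otimes>\<^bsub>C\<^esub> tensor_power C V n"

text \<open>
  For \<open>\<phi> : V\<^sup>l \<rightarrow> V\<^sup>r\<close>, \<open>leg C V k i \<phi> : V\<^sup>(\<^sup>k\<^sup>+\<^sup>l\<^sup>) \<rightarrow> V\<^sup>(\<^sup>k\<^sup>+\<^sup>r\<^sup>)\<close> is \<open>\<phi>\<^sub>i\<close>, where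
  \<open>1 \<le> i \<le> k + 1\<close>; the number \<open>k\<close> of untouched strands, implicit in the notation
  \<open>\<phi>\<^sub>i\<close>, is made explicit.
\<close>

definition leg :: "('o, 'm) monoidal_data \<Rightarrow> 'o \<Rightarrow> nat \<Rightarrow> nat \<Rightarrow> 'm \<Rightarrow> 'm" where
  "leg C V k i \<phi> =
    Id\<^bsub>C\<^esub> (tensor_power C V (i - 1)) \<boxtimes>\<^bsub>C\<^esub> \<phi> \<boxtimes>\<^bsub>C\<^esub> Id\<^bsub>C\<^esub> (tensor_power C V (k + 1 - i))"

text \<open>
  For \<open>\<phi> : V\<^sup>l \<rightarrow> V\<^sup>r\<close>, \<open>iter_leg C V l r m n \<phi>\<close> is \<open>\<phi>\<^sup>n = \<phi>\<^sub>1 \<circ> \<dots> \<circ> \<phi>\<^sub>1\<close> with source \<open>V\<^sup>m\<close>.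
  The factors \<open>\<phi>\<^sub>1\<close> act on different tensor powers: the first one applied leaves
  \<open>m - l\<close> strands untouched and lands in \<open>V\<^sup>(\<^sup>m\<^sup>-\<^sup>l\<^sup>+\<^sup>r\<^sup>)\<close>, the source of the next one.
  This is meaningful only if at least \<open>l\<close> strands are left at each step.
\<close>

primrec iter_leg ::
    "('o, 'm) monoidal_data \<Rightarrow> 'o \<Rightarrow> nat \<Rightarrow> nat \<Rightarrow> nat \<Rightarrow> nat \<Rightarrow> 'm \<Rightarrow> 'm" where
  "iter_leg C V l r m 0 \<phi> = Id\<^bsub>C\<^esub> (tensor_power C V m)"
| "iter_leg C V l r m (Suc n) \<phi> =
    iter_leg C V l r (m - l + r) n \<phi> \<cdot>\<^bsub>C\<^esub> leg C V (m - l) 1 \<phi>"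


section \<open>Shelves in a symmetric category\<close>

definition coassociative :: "('o, 'm) monoidal_data \<Rightarrow> 'o \<Rightarrow> 'm \<Rightarrow> bool" where
  "coassociative C V \<Delta> \<longleftrightarrow> leg C V 1 1 \<Delta> \<cdot>\<^bsub>C\<^esub> \<Delta> = leg C V 1 2 \<Delta> \<cdot>\<^bsub>C\<^esub> \<Delta>"

definition weakly_cocommutative :: "('o, 'm) monoidal_data \<Rightarrow> 'o \<Rightarrow> 'm \<Rightarrow> bool" where
  "weakly_cocommutative C V \<Delta> \<longleftrightarrow>
    leg C V 2 2 (\<c>\<^bsub>C\<^esub> V V) \<cdot>\<^bsub>C\<^esub> iter_leg C V 1 2 1 3 \<Delta> = iter_leg C V 1 2 1 3 \<Delta>"

definition GSD :: "('o, 'm) monoidal_data \<Rightarrow> 'o \<Rightarrow> 'm \<Rightarrow> 'm \<Rightarrow> bool" where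
  "GSD C V \<Delta> lhd \<longleftrightarrow>
    iter_leg C V 2 1 3 2 lhd =
      lhd \<cdot>\<^bsub>C\<^esub> (lhd \<boxtimes>\<^bsub>C\<^esub> lhd) \<cdot>\<^bsub>C\<^esub> leg C V 2 2 (\<c>\<^bsub>C\<^esub> V V) \<cdot>\<^bsub>C\<^esub> leg C V 2 3 \<Delta>"

definition shelf_compatible :: "('o, 'm) monoidal_data \<Rightarrow> 'o \<Rightarrow> 'm \<Rightarrow> 'm \<Rightarrow> bool" where
  "shelf_compatible C V \<Delta> lhd \<longleftrightarrow>
    \<Delta> \<cdot>\<^bsub>C\<^esub> lhd = (lhd \<boxtimes>\<^bsub>C\<^esub> lhd) \<cdot>\<^bsub>C\<^esub> leg C V 2 2 (\<c>\<^bsub>C\<^esub> V V) \<cdot>\<^bsub>C\<^esub> (\<Delta> \<boxtimes>\<^bsub>C\<^esub> \<Delta>)"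

definition shelf_without_GSD :: "('o, 'm) monoidal_data \<Rightarrow> 'o \<Rightarrow> 'm \<Rightarrow> 'm \<Rightarrow> bool" where
  "shelf_without_GSD C V \<Delta> lhd \<longleftrightarrow>
    V \<in> Obj C \<and> \<Delta> \<in> Hom C V (V \<otimes>\<^bsub>C\<^esub> V) \<and> lhd \<in> Hom C (V \<otimes>\<^bsub>C\<^esub> V) V \<and>
    coassociative C V \<Delta> \<and> weakly_cocommutative C V \<Delta> \<and> shelf_compatible C V \<Delta> lhd"

definition shelf :: "('o, 'm) monoidal_data \<Rightarrow> 'o \<Rightarrow> 'm \<Rightarrow> 'm \<Rightarrow> bool" where
  "shelf C V \<Delta> lhd \<longleftrightarrow> shelf_without_GSD C V \<Delta> lhd \<and> GSD C V \<Delta> lhd"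

definition shelf_braiding :: "('o, 'm) monoidal_data \<Rightarrow> 'o \<Rightarrow> 'm \<Rightarrow> 'm \<Rightarrow> 'm" where
  "shelf_braiding C V \<Delta> lhd = leg C V 1 2 lhd \<cdot>\<^bsub>C\<^esub> leg C V 1 1 (\<c>\<^bsub>C\<^esub> V V) \<cdot>\<^bsub>C\<^esub> leg C V 1 2 \<Delta>"


section \<open>Algebras in a symmetric category\<close>

definition right_unit :: "('o, 'm) monoidal_data \<Rightarrow> 'o \<Rightarrow> 'm \<Rightarrow> 'm \<Rightarrow> bool" where
  "right_unit C V \<mu> \<nu> \<longleftrightarrow> \<mu> \<cdot>\<^bsub>C\<^esub> (Id\<^bsub>C\<^esub> V \<boxtimes>\<^bsub>C\<^esub> \<nu>) = Id\<^bsub>C\<^esub> V"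

definition left_unit :: "('o, 'm) monoidal_data \<Rightarrow> 'o \<Rightarrow> 'm \<Rightarrow> 'm \<Rightarrow> bool" where
  "left_unit C V \<mu> \<nu> \<longleftrightarrow> \<mu> \<cdot>\<^bsub>C\<^esub> (\<nu> \<boxtimes>\<^bsub>C\<^esub> Id\<^bsub>C\<^esub> V) = Id\<^bsub>C\<^esub> V"

definition associative :: "('o, 'm) monoidal_data \<Rightarrow> 'o \<Rightarrow> 'm \<Rightarrow> bool" where
  "associative C V \<mu> \<longleftrightarrow>
    \<mu> \<cdot>\<^bsub>C\<^esub> (\<mu> \<boxtimes>\<^bsub>C\<^esub> Id\<^bsub>C\<^esub> V) = \<mu> \<cdot>\<^bsub>C\<^esub> (Id\<^bsub>C\<^esub> V \<boxtimes>\<^bsub>C\<^esub> \<mu>)"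

definition unital_associative_algebra ::
    "('o, 'm) monoidal_data \<Rightarrow> 'o \<Rightarrow> 'm \<Rightarrow> 'm \<Rightarrow> bool" where
  "unital_associative_algebra C V \<mu> \<nu> \<longleftrightarrow>
    V \<in> Obj C \<and> \<mu> \<in> Hom C (V \<otimes>\<^bsub>C\<^esub> V) V \<and> \<nu> \<in> Hom C \<I>\<^bsub>C\<^esub> V \<and>
    associative C V \<mu> \<and> left_unit C V \<mu> \<nu> \<and> right_unit C V \<mu> \<nu>"

definition Delta_Ass :: "('o, 'm) monoidal_data \<Rightarrow> 'o \<Rightarrow> 'm \<Rightarrow> 'm" where
  "Delta_Ass C V \<nu> = \<nu> \<boxtimes>\<^bsub>C\<^esub> Id\<^bsub>C\<^esub> V"

definition algebra_braiding :: "('o, 'm) monoidal_data \<Rightarrow> 'm \<Rightarrow> 'm \<Rightarrow> 'm" where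
  "algebra_braiding C \<mu> \<nu> = \<nu> \<boxtimes>\<^bsub>C\<^esub> \<mu>"

end

theory Submission
  imports Defs
begin

text \<open>
  A morphism out of the unit object passes freely through the symmetry, because
  \<open>\<c> A \<I>\<close> is an identity. Hence \<open>\<c>\<^sub>2\<close> only moves the inserted copies of \<open>\<nu>\<close>:
  in GSD and in the compatibility axiom one of them ends up as the right argument of the first
  \<open>\<mu>\<close>, where the right unit law absorbs it. The right-hand side of GSD becomes
  \<open>\<mu> \<cdot> (Id V \<boxtimes> \<mu>)\<close>.
\<close>

section \<open>Interchange law and unit strands in a strict monoidal category\<close>

lemma (in category) HomD:
  assumes "f \<in> Hom C A B"
  shows "f \<in> Mor C" "A \<in> Obj C" "B \<in> Obj C"
  using assms dom_closed cod_closed by (auto simp: Hom_def)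

context strict_monoidal_category
begin

lemma tensor_assoc:
  assumes "f \<in> Hom C A B" "g \<in> Hom C A' B'" "h \<in> Hom C A'' B''"
  shows "(f \<boxtimes> g) \<boxtimes> h = f \<boxtimes> g \<boxtimes> h"
  using assms by (blast intro: tensor_mor_assoc HomD)

lemma post_tensor_left:
  assumes "f \<in> Hom C A B" "g \<in> Hom C B D" "h \<in> Hom C A' B'"
  shows "(g \<boxtimes> Id B') \<cdot> (f \<boxtimes> h) = (g \<cdot> f) \<boxtimes> h"
  using assms tensor_compose[OF assms(1,2,3)] ident_closed HomD compose_ident_left by metis

lemma post_tensor_right:
  assumes "f \<in> Hom C A B" "g \<in> Hom C B D" "h \<in> Hom C A' B'"
  shows "(Id B' \<boxtimes> g) \<cdot> (h \<boxtimes> f) = h \<boxtimes> (g \<cdot> f)"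
  using assms tensor_compose[OF assms(3) _ assms(1,2)] ident_closed HomD compose_ident_left
  by metis

lemma post_tensor_middle:
  assumes "f \<in> Hom C A B" "g \<in> Hom C B D" "p \<in> Hom C P P'" "q \<in> Hom C Q Q'"
  shows "(Id P' \<boxtimes> g \<boxtimes> Id Q') \<cdot> (p \<boxtimes> f \<boxtimes> q) = p \<boxtimes> (g \<cdot> f) \<boxtimes> q"
proof -
  have "(Id P' \<boxtimes> g \<boxtimes> Id Q') \<cdot> (p \<boxtimes> f \<boxtimes> q) = p \<boxtimes> ((g \<boxtimes> Id Q') \<cdot> (f \<boxtimes> q))"
    using assms by (blast intro: post_tensor_right tensor_mor_closed ident_closed HomD)
  then show ?thesis
    using assms by (simp add: post_tensor_left)
qed

text \<open>By strictness \<open>f\<close> is \<open>Id \<I> \<boxtimes> f\<close>, so the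
  interchange law applies. This turns composing with an inserted \<open>n\<close> into tensoring
  with it.\<close>

lemma tensor_unit_source_compose:
  assumes "n \<in> Hom C \<I> A" "f \<in> Hom C B D"
  shows "(n \<boxtimes> Id D) \<cdot> f = n \<boxtimes> f"
proof -
  have "(n \<boxtimes> Id D) \<cdot> (Id \<I> \<boxtimes> f) = (n \<cdot> Id \<I>) \<boxtimes> f"
    using assms by (blast intro: post_tensor_left ident_closed unit_obj_closed)
  then show ?thesis
    using assms by (simp add: tensor_mor_unit_left HomD compose_ident_right)
qed

lemma tensor_mor_closed_unit_left:
  assumes "n \<in> Hom C \<I> A" "f \<in> Hom C B D"
  shows "n \<boxtimes> f \<in> Hom C B (A \<otimes> D)"
  using tensor_mor_closed[OF assms] assms by (simp add: tensor_obj_unit_left HomD)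

lemma tensor_mor_closed_unit_right:
  assumes "f \<in> Hom C B D" "n \<in> Hom C \<I> A"
  shows "f \<boxtimes> n \<in> Hom C B (D \<otimes> A)"
  using tensor_mor_closed[OF assms] assms by (simp add: tensor_obj_unit_right HomD)

lemma tensor_power_1: "V \<in> Obj C \<Longrightarrow> tensor_power C V (Suc 0) = V"
  by (simp add: tensor_obj_unit_right)

lemma tensor_power_2: "V \<in> Obj C \<Longrightarrow> tensor_power C V (Suc (Suc 0)) = V \<otimes> V"
  by (simp add: tensor_obj_unit_right)

lemma leg_first:
  assumes "\<phi> \<in> Hom C A B" "V \<in> Obj C"
  shows "leg C V k (Suc 0) \<phi> = \<phi> \<boxtimes> Id (tensor_power C V k)"
proof -
  have "tensor_power C V k \<in> Obj C"
    by (induction k) (simp_all add: unit_obj_closed tensor_obj_closed assms)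
  then have "\<phi> \<boxtimes> Id (tensor_power C V k) \<in> Mor C"
    using assms by (blast intro: HomD tensor_mor_closed ident_closed)
  then show ?thesis
    by (simp add: leg_def tensor_mor_unit_left)
qed

lemma leg_last:
  assumes "\<phi> \<in> Hom C A B"
  shows "leg C V k (Suc k) \<phi> = Id (tensor_power C V k) \<boxtimes> \<phi>"
  using assms by (simp add: leg_def tensor_mor_unit_right HomD)

end

section \<open>The symmetry and morphisms out of the unit object\<close>

context strict_symmetric_category
begin

text \<open>The hexagon with both right-hand objects equal to \<open>\<I>\<close> makes
  \<open>\<c> A \<I>\<close> idempotent; symmetry makes it invertible, and an invertible idempotent
  is an identity.\<close>

lemma braid_unit_right:
  assumes A: "A \<in> Obj C"
  shows "\<c> A \<I> = Id A"
proof -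
  note I = unit_obj_closed
  have c: "\<c> A \<I> \<in> Hom C A A" and d: "\<c> \<I> A \<in> Hom C A A"
    using braid_closed[OF A I] braid_closed[OF I A] A
    by (simp_all add: tensor_obj_unit_left tensor_obj_unit_right)
  have inv: "\<c> \<I> A \<cdot> \<c> A \<I> = Id A"
    using braid_symmetric[OF A I] A by (simp add: tensor_obj_unit_right)
  have "\<c> A \<I> = \<c> A \<I> \<cdot> \<c> A \<I>"
    using braid_hexagon[OF A I I] c I
    by (simp add: tensor_obj_unit_left tensor_mor_unit_left tensor_mor_unit_right HomD)
  then have "Id A = (\<c> \<I> A \<cdot> \<c> A \<I>) \<cdot> \<c> A \<I>"
    using compose_assoc[OF c c d] inv by simp
  then show ?thesis
    using inv compose_ident_left[OF c] by simp
qed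

text \<open>Naturality leaves the factor \<open>\<c> A \<I>\<close> on the right, which is an
  identity.\<close>

lemma braid_compose_unit_source:
  assumes "f \<in> Hom C A B" "n \<in> Hom C \<I> D"
  shows "\<c> B D \<cdot> (f \<boxtimes> n) = n \<boxtimes> f"
  using braid_natural[OF assms] assms
  by (simp add: braid_unit_right HomD compose_ident_right[OF tensor_mor_closed_unit_left])

text \<open>The sources of \<open>p\<close>, \<open>f\<close>, \<open>q\<close> are arbitrary, so
  each may be \<open>\<nu>\<close> or \<open>Id V\<close>; this one form serves weak
  cocommutativity, compatibility and GSD.\<close>

lemma leg_braid_compose:
  assumes "p \<in> Hom C P V" "f \<in> Hom C A V" "n \<in> Hom C \<I> V" "q \<in> Hom C Q V"
  shows "leg C V 2 2 (\<c> V V) \<cdot> (p \<boxtimes> f \<boxtimes> n \<boxtimes> q) = p \<boxtimes> n \<boxtimes> f \<boxtimes> q"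
proof -
  have V: "V \<in> Obj C"
    using assms(1) by (rule HomD)
  have "(Id V \<boxtimes> \<c> V V \<boxtimes> Id V) \<cdot> (p \<boxtimes> (f \<boxtimes> n) \<boxtimes> q) = p \<boxtimes> (\<c> V V \<cdot> (f \<boxtimes> n)) \<boxtimes> q"
    using assms V by (blast intro: post_tensor_middle tensor_mor_closed braid_closed)
  also have "\<dots> = p \<boxtimes> (n \<boxtimes> f) \<boxtimes> q"
    by (simp add: braid_compose_unit_source[OF assms(2,3)])
  finally show ?thesis
    using V by (simp add: leg_def tensor_obj_unit_right tensor_assoc[OF assms(2,3,4)]
      tensor_assoc[OF assms(3,2,4)])
qed

end

section \<open>The shelf axioms and the braiding for \<open>\<Delta>\<close> and
  \<open>\<mu>\<close>\<close>

locale right_unital_magma = strict_symmetric_category +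
  fixes V :: 'a and \<mu> \<nu> :: 'b
  assumes V: "V \<in> Obj C"
    and \<mu>: "\<mu> \<in> Hom C (V \<otimes> V) V"
    and \<nu>: "\<nu> \<in> Hom C \<I> V"
    and right_unit: "right_unit C V \<mu> \<nu>"
begin

abbreviation \<Delta> :: 'b where "\<Delta> \<equiv> Delta_Ass C V \<nu>"

lemma Id_V: "Id V \<in> Hom C V V"
  using V by (rule ident_closed)

lemma Id_VV: "Id (V \<otimes> V) \<in> Hom C (V \<otimes> V) (V \<otimes> V)"
  using V by (blast intro: ident_closed tensor_obj_closed)

lemma Delta_closed: "\<Delta> \<in> Hom C V (V \<otimes> V)"
  unfolding Delta_Ass_def by (rule tensor_mor_closed_unit_left[OF \<nu> Id_V])

lemma \<nu>_tensor_Delta_closed: "\<nu> \<boxtimes> \<Delta> \<in> Hom C V (V \<otimes> V \<otimes> V)"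
  by (rule tensor_mor_closed_unit_left[OF \<nu> Delta_closed])

text \<open>By strictness \<open>\<Delta> \<boxtimes> Id V\<close> again just inserts
  \<open>\<nu>\<close> on the far left. The value is shared by coassociativity and the threefold
  iterate of \<open>\<Delta>\<close>.\<close>

lemma Delta_Delta: "leg C V 1 1 \<Delta> \<cdot> \<Delta> = \<nu> \<boxtimes> \<Delta>"
proof -
  have "(\<Delta> \<boxtimes> Id V) \<cdot> \<Delta> = (\<nu> \<boxtimes> Id (V \<otimes> V)) \<cdot> \<Delta>"
    by (simp add: Delta_Ass_def tensor_assoc[OF \<nu> Id_V Id_V] tensor_ident V)
  also have "\<dots> = \<nu> \<boxtimes> \<Delta>"
    by (rule tensor_unit_source_compose[OF \<nu> Delta_closed])
  finally show ?thesis
    by (simp add: leg_first[OF Delta_closed V] tensor_power_1 V del: tensor_power.simps)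
qed

lemma coassociative_Delta: "coassociative C V \<Delta>"
proof -
  \<comment> \<open>Here the second \<open>\<nu>\<close> is inserted to the right of the first one,
    with the same outcome.\<close>
  have "(Id V \<boxtimes> \<Delta>) \<cdot> (\<nu> \<boxtimes> Id V) = \<nu> \<boxtimes> (\<Delta> \<cdot> Id V)"
    by (rule post_tensor_right[OF Id_V Delta_closed \<nu>])
  also have "\<dots> = \<nu> \<boxtimes> \<Delta>"
    by (simp add: compose_ident_right[OF Delta_closed])
  finally have "leg C V 1 2 \<Delta> \<cdot> \<Delta> = \<nu> \<boxtimes> \<Delta>"
    using leg_last[OF Delta_closed, of V 1]
    by (simp add: Delta_Ass_def numeral_2_eq_2 tensor_power_1 V del: tensor_power.simps)
  then show ?thesis
    using Delta_Delta by (simp add: coassociative_def)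
qed

lemma iter_Delta: "iter_leg C V 1 2 1 3 \<Delta> = \<nu> \<boxtimes> \<nu> \<boxtimes> \<nu> \<boxtimes> Id V"
proof -
  let ?D2 = "leg C V 1 1 \<Delta>" and ?D3 = "leg C V 2 1 \<Delta>"
  have VVV: "V \<otimes> V \<otimes> V \<in> Obj C"
    using V by (simp add: tensor_obj_closed)
  have D3: "?D3 = \<nu> \<boxtimes> Id (V \<otimes> V \<otimes> V)"
    using leg_first[OF Delta_closed V, of 2]
    by (simp add: numeral_2_eq_2 tensor_power_2 V Delta_Ass_def tensor_assoc[OF \<nu> Id_V Id_VV]
      tensor_ident tensor_obj_closed del: tensor_power.simps)
  have D2_closed: "?D2 \<in> Hom C (V \<otimes> V) (V \<otimes> V \<otimes> V)"
    using tensor_mor_closed[OF Delta_closed Id_V] V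
    by (simp add: leg_first[OF Delta_closed V] tensor_power_1 tensor_obj_assoc
      del: tensor_power.simps)
  have D3_closed: "?D3 \<in> Hom C (V \<otimes> V \<otimes> V) (V \<otimes> V \<otimes> V \<otimes> V)"
    unfolding D3 by (rule tensor_mor_closed_unit_left[OF \<nu> ident_closed[OF VVV]])
  \<comment> \<open>The sources run through \<open>V\<close>, its square and its cube. The first
    factor has no untouched strand and is \<open>\<Delta>\<close> itself; the identity on the fourth
    power comes from the base case of \<open>iter_leg\<close>.\<close>
  have "iter_leg C V 1 2 1 3 \<Delta> = ((Id (V \<otimes> V \<otimes> V \<otimes> V) \<cdot> ?D3) \<cdot> ?D2) \<cdot> \<Delta>"
    by (simp add: numeral_3_eq_3 numeral_2_eq_2 leg_first[OF Delta_closed V, of 0]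
      tensor_mor_unit_right HomD[OF Delta_closed] tensor_obj_unit_right V)
  also have "\<dots> = ?D3 \<cdot> ?D2 \<cdot> \<Delta>"
    by (simp only: compose_ident_left[OF D3_closed]
      compose_assoc[OF Delta_closed D2_closed D3_closed])
  also have "\<dots> = \<nu> \<boxtimes> \<nu> \<boxtimes> \<Delta>"
    unfolding Delta_Delta D3 by (rule tensor_unit_source_compose[OF \<nu> \<nu>_tensor_Delta_closed])
  finally show ?thesis
    by (simp add: Delta_Ass_def)
qed

text \<open>The second and third tensor factors of the iterate are both \<open>\<nu>\<close>, so
  exchanging them changes nothing.\<close>

lemma weakly_cocommutative_Delta: "weakly_cocommutative C V \<Delta>"
  unfolding weakly_cocommutative_def iter_Delta
  by (rule leg_braid_compose[OF \<nu> \<nu> \<nu> Id_V])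

text \<open>Interchange splits the composite into
  \<open>\<mu> \<cdot> (x \<boxtimes> \<nu>)\<close>, which the right unit law reduces to
  \<open>x\<close>, and \<open>\<mu>\<close> on the last two strands. Compatibility takes
  \<open>x\<close> to be \<open>\<nu>\<close>, GSD takes \<open>Id V\<close>.\<close>

lemma mult_tensor_mult_unit:
  assumes "x \<in> Hom C A V"
  shows "(\<mu> \<boxtimes> \<mu>) \<cdot> (x \<boxtimes> \<nu> \<boxtimes> Id (V \<otimes> V)) = x \<boxtimes> \<mu>"
proof -
  have xn: "x \<boxtimes> \<nu> \<in> Hom C A (V \<otimes> V)"
    by (rule tensor_mor_closed_unit_right[OF assms \<nu>])
  have Idn: "Id V \<boxtimes> \<nu> \<in> Hom C V (V \<otimes> V)"
    by (rule tensor_mor_closed_unit_right[OF Id_V \<nu>])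
  \<comment> \<open>Reading \<open>x\<close> as \<open>x \<boxtimes> Id \<I>\<close> carries the
    right unit law from \<open>Id V\<close> to any \<open>x\<close> into \<open>V\<close>.\<close>
  have "(Id V \<boxtimes> \<nu>) \<cdot> x = x \<boxtimes> \<nu>"
    using post_tensor_right[OF ident_closed[OF unit_obj_closed] \<nu> assms] assms
    by (simp add: tensor_mor_unit_right HomD compose_ident_right[OF \<nu>])
  then have "\<mu> \<cdot> (x \<boxtimes> \<nu>) = x"
    using compose_assoc[OF assms Idn \<mu>] right_unit
    by (simp add: right_unit_def compose_ident_left[OF assms])
  then show ?thesis
    using tensor_compose[OF xn \<mu> Id_VV \<mu>]
    by (simp add: compose_ident_right[OF \<mu>] tensor_assoc[OF assms \<nu> Id_VV])
qed

lemma shelf_compatible_Delta: "shelf_compatible C V \<Delta> \<mu>"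
proof -
  have "leg C V 2 2 (\<c> V V) \<cdot> (\<Delta> \<boxtimes> \<Delta>) = \<nu> \<boxtimes> \<nu> \<boxtimes> Id (V \<otimes> V)"
    using leg_braid_compose[OF \<nu> Id_V \<nu> Id_V]
      tensor_assoc[OF \<nu> Id_V Delta_closed]
    by (simp add: Delta_Ass_def tensor_ident V)
  moreover have "\<Delta> \<cdot> \<mu> = \<nu> \<boxtimes> \<mu>"
    unfolding Delta_Ass_def by (rule tensor_unit_source_compose[OF \<nu> \<mu>])
  ultimately show ?thesis
    by (simp add: shelf_compatible_def mult_tensor_mult_unit[OF \<nu>])
qed

lemma iter_mult: "iter_leg C V 2 1 3 2 \<mu> = \<mu> \<cdot> (\<mu> \<boxtimes> Id V)"
proof -
  \<comment> \<open>The first product leaves one of three strands untouched, the second leaves none;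
    \<open>Id V\<close> is the base case.\<close>
  have "iter_leg C V 2 1 3 2 \<mu> = (Id V \<cdot> \<mu>) \<cdot> (\<mu> \<boxtimes> Id V)"
    by (simp add: numeral_3_eq_3 numeral_2_eq_2 leg_first[OF \<mu> V]
      tensor_mor_unit_right HomD[OF \<mu>] tensor_obj_unit_right V)
  then show ?thesis
    by (simp add: compose_ident_left[OF \<mu>])
qed

lemma GSD_Delta_iff_associative: "GSD C V \<Delta> \<mu> \<longleftrightarrow> associative C V \<mu>"
proof -
  \<comment> \<open>Splitting the identity on \<open>V \<otimes> V\<close> exposes the second
    strand, which \<open>\<nu>\<close> then crosses.\<close>
  have "leg C V 2 3 \<Delta> = Id V \<boxtimes> Id V \<boxtimes> \<nu> \<boxtimes> Id V"
    using leg_last[OF Delta_closed, of V 2] tensor_assoc[OF Id_V Id_V Delta_closed]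
    by (simp add: numeral_3_eq_3 numeral_2_eq_2 tensor_power_2 V Delta_Ass_def tensor_ident
      del: tensor_power.simps)
  then have "leg C V 2 2 (\<c> V V) \<cdot> leg C V 2 3 \<Delta> = Id V \<boxtimes> \<nu> \<boxtimes> Id (V \<otimes> V)"
    using leg_braid_compose[OF Id_V Id_V \<nu> Id_V] by (simp add: tensor_ident V)
  then show ?thesis
    unfolding GSD_def iter_mult by (simp add: associative_def mult_tensor_mult_unit[OF Id_V])
qed

text \<open>The \<open>\<nu>\<close> inserted between the two strands is carried by the symmetry to
  the far left, after which \<open>\<mu>\<close> multiplies the two original strands.\<close>

lemma shelf_braiding_Delta: "shelf_braiding C V \<Delta> \<mu> = algebra_braiding C \<mu> \<nu>"
proof -
  have "(\<c> V V \<boxtimes> Id V) \<cdot> ((Id V \<boxtimes> \<nu>) \<boxtimes> Id V) = (\<c> V V \<cdot> (Id V \<boxtimes> \<nu>)) \<boxtimes> Id V"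
    using V by (blast intro: post_tensor_left tensor_mor_closed Id_V \<nu> braid_closed)
  then have "(\<c> V V \<boxtimes> Id V) \<cdot> (Id V \<boxtimes> \<Delta>) = \<nu> \<boxtimes> Id (V \<otimes> V)"
    by (simp add: braid_compose_unit_source[OF Id_V \<nu>] tensor_assoc[OF Id_V \<nu> Id_V]
      tensor_assoc[OF \<nu> Id_V Id_V] Delta_Ass_def tensor_ident V)
  moreover have "(Id V \<boxtimes> \<mu>) \<cdot> (\<nu> \<boxtimes> Id (V \<otimes> V)) = \<nu> \<boxtimes> \<mu>"
    using post_tensor_right[OF Id_VV \<mu> \<nu>] by (simp add: compose_ident_right[OF \<mu>])
  ultimately show ?thesis
    using leg_last[OF Delta_closed, of V 1] leg_last[OF \<mu>, of V 1]
      leg_first[OF braid_closed[OF V V] V, of 1]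
    by (simp add: shelf_braiding_def algebra_braiding_def numeral_2_eq_2 tensor_power_1 V
      del: tensor_power.simps)
qed

end

theorem proposition4p15:
  fixes C :: "('o, 'm) monoidal_data" (structure)
    and V :: 'o and \<mu> \<nu> :: 'm
  assumes "strict_symmetric_category C"
    and "V \<in> Obj C"
    and "\<mu> \<in> Hom C (V \<otimes> V) V"
    and "\<nu> \<in> Hom C \<I> V"
    and "right_unit C V \<mu> \<nu>"
  shows "shelf_without_GSD C V (Delta_Ass C V \<nu>) \<mu>
    \<and> (GSD C V (Delta_Ass C V \<nu>) \<mu> \<longleftrightarrow> associative C V \<mu>)
    \<and> (unital_associative_algebra C V \<mu> \<nu> \<longrightarrow>
        shelf_braiding C V (Delta_Ass C V \<nu>) \<mu> = algebra_braiding C \<mu> \<nu>)"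
proof -
  interpret right_unital_magma C V \<mu> \<nu>
    using assms by (simp add: right_unital_magma_def right_unital_magma_axioms_def)
  show ?thesis
    by (simp add: shelf_without_GSD_def V Delta_closed \<mu> coassociative_Delta
      weakly_cocommutative_Delta shelf_compatible_Delta GSD_Delta_iff_associative
      shelf_braiding_Delta)
qed

end
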